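(* Let $\Gamma$ be a finite simple undirected graph with more than one vertex. If $\Gamma$ is regular and self-complementary, then the diameter of $\Gamma$ is equal to $2$ (in particular, $\Gamma$ is connected).
   Context: All graphs are finite, undirected and simple (no loops or multiple edges). The complement $\Gamma^{c}$ of a graph $\Gamma$ has the same vertex set as $\Gamma$, and two distinct vertices are adjacent in $\Gamma^{c}$ if and only if they are not adjacent in $\Gamma$. A graph is self-complementary if it is isomorphic to its complement. A graph is regular if all its vertices have the same degree. The diameter of a connected graph is the maximum distance between two of its vertices. *)

theory Defs
  imports "Graph_Theory.Graph_Theory"
begin

text \<open>
  A finite simple undirected graph is a \<open>pair_graph\<close>: a finite, loop-free digraph whose arcs are
  ordered pairs of vertices and whose arc set is symmetric, so an edge between \<open>u\<close> and \<open>v\<close> is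
  represented by the two arcs \<open>(u, v)\<close> and \<open>(v, u)\<close>.
\<close>

definition complement :: "'a pair_pre_digraph \<Rightarrow> 'a pair_pre_digraph" where
  "complement G =
     \<lparr> pverts = pverts G,
       parcs = {(u, v). u \<in> pverts G \<and> v \<in> pverts G \<and> u \<noteq> v \<and> (u, v) \<notin> parcs G} \<rparr>"

definition self_complementary :: "'a pair_pre_digraph \<Rightarrow> bool" where
  "self_complementary G \<longleftrightarrow> digraph_iso (with_proj G) (with_proj (complement G))"

text \<open>In a symmetric digraph without loops, the out-degree of a vertex is its number of neighbours.\<close>

definition regular :: "'a pair_pre_digraph \<Rightarrow> bool" where
  "regular G \<longleftrightarrow> (\<exists>k. \<forall>v \<in> pverts G. out_degree (with_proj G) v = k)"

text \<open>
  The distance is the least number of arcs of a walk, i.e. the cost of a shortest walk when every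
  arc has weight 1; it is \<open>\<infinity>\<close> when there is no walk.
\<close>

definition graph_dist :: "'a pair_pre_digraph \<Rightarrow> 'a \<Rightarrow> 'a \<Rightarrow> ereal" where
  "graph_dist G u v = wf_digraph.\<mu> (with_proj G) (\<lambda>_. 1) u v"

text \<open>
  For a nonempty finite graph the supremum below ranges over a nonempty finite set, hence is a
  maximum; it is \<open>\<infinity>\<close> when the graph is disconnected.
\<close>

definition graph_diameter :: "'a pair_pre_digraph \<Rightarrow> ereal" where
  "graph_diameter G = (SUP u \<in> pverts G. SUP v \<in> pverts G. graph_dist G u v)"

end

theory Submission
  imports Defs
begin

text \<open>
  A \<open>k\<close>-regular graph on \<open>n\<close> vertices has \<open>n k\<close> arcs, and together with its complement it has
  all \<open>n (n - 1)\<close> ordered pairs of distinct vertices as arcs. An isomorphism preserves the number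
  of arcs, so self-complementarity gives \<open>2 n k = n (n - 1)\<close>, that is, \<open>n = 2 k + 1\<close>
  (lemma \<open>regular_self_complementary_card_verts\<close>).

  Two distinct non-adjacent vertices then have a common neighbour
  (lemma \<open>nonadjacent_common_neighbour\<close>): their neighbourhoods have \<open>k\<close> elements each but lie in
  the remaining \<open>n - 2 = 2 k - 1 < 2 k\<close> vertices, so they cannot be disjoint. Hence any two vertices
  are at distance at most 2. The value 2 is attained, because a vertex adjacent to all others would
  have \<open>k = n - 1 = 2 k\<close>, forcing \<open>k = 0\<close> and \<open>n = 1\<close>.
\<close>

abbreviation neighbours :: "'a pair_pre_digraph \<Rightarrow> 'a \<Rightarrow> 'a set" where
  "neighbours G v \<equiv> parcs G `` {v}"

lemma out_degree_eq_card_neighbours: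
  "out_degree (with_proj G) v = card (neighbours G v)"
proof -
  have "out_arcs (with_proj G) v = Pair v ` neighbours G v"
    by (auto simp: out_arcs_def)
  then show ?thesis
    by (simp add: out_degree_def card_image inj_on_def)
qed

lemma (in pair_fin_digraph) card_parcs_eq_sum_neighbours:
  "card (parcs G) = (\<Sum>v\<in>pverts G. card (neighbours G v))"
proof -
  have "parcs G = (SIGMA v:pverts G. neighbours G v)"
    by (auto dest: wellformed')
  moreover have "finite (neighbours G v)" for v
    using pair_finite_arcs by simp
  ultimately show ?thesis
    using card_SigmaI[of "pverts G" "neighbours G"] pair_finite_verts by simp
qed

lemma (in pair_digraph) card_parcs_plus_complement:
  "card (parcs G) + card (parcs (complement G)) = card (pverts G) * (card (pverts G) - 1)"
proof -
  let ?A = "SIGMA u:pverts G. pverts G - {u}"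
  have union: "parcs G \<union> parcs (complement G) = ?A"
    by (auto simp: complement_def dest: wellformed' pair_no_loops)
  have "card (parcs G) + card (parcs (complement G)) = card ?A"
  proof (subst union[symmetric], rule card_Un_disjoint[symmetric])
    show "finite (parcs G)" by (rule pair_finite_arcs)
    have "parcs (complement G) \<subseteq> pverts G \<times> pverts G"
      by (auto simp: complement_def)
    then show "finite (parcs (complement G))"
      using pair_finite_verts finite_subset by blast
    show "parcs G \<inter> parcs (complement G) = {}"
      by (auto simp: complement_def)
  qed
  also have "\<dots> = (\<Sum>u\<in>pverts G. card (pverts G - {u}))"
    using pair_finite_verts by (intro card_SigmaI) auto
  also have "\<dots> = card (pverts G) * (card (pverts G) - 1)"
    by simp
  finally show ?thesis .
qed

lemma digraph_iso_card_arcs: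
  assumes "digraph_iso G H"
  shows "card (arcs H) = card (arcs G)"
  using assms
  by (auto simp: digraph_iso_def pre_digraph.digraph_isomorphism_def card_image)

text \<open>
  Double counting: the graph and its complement have equally many arcs, so each has half of the
  \<open>n (n - 1)\<close> possible ones.
\<close>
lemma (in pair_digraph) regular_self_complementary_card_verts:
  assumes "pverts G \<noteq> {}"
    and degree: "\<And>v. v \<in> pverts G \<Longrightarrow> card (neighbours G v) = k"
    and "self_complementary G"
  shows "card (pverts G) = 2 * k + 1"
proof -
  let ?n = "card (pverts G)"
  have "?n > 0"
    using assms(1) pair_finite_verts by (simp add: card_gt_0_iff)
  have "card (parcs G) = ?n * k"
    using degree by (simp add: card_parcs_eq_sum_neighbours)
  moreover have "card (parcs (complement G)) = card (parcs G)"
    using assms(3) digraph_iso_card_arcs by (fastforce simp: self_complementary_def)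
  ultimately have "?n * (2 * k) = ?n * (?n - 1)"
    using card_parcs_plus_complement by (simp add: algebra_simps)
  then have "2 * k = ?n - 1"
    using \<open>?n > 0\<close> by (metis mult_cancel1 less_irrefl)
  then show ?thesis
    using \<open>?n > 0\<close> by linarith
qed

text \<open>
  Pigeonhole: non-adjacency confines both neighbourhoods to the \<open>n - 2\<close> vertices other than \<open>u\<close>
  and \<open>v\<close>, while their sizes add up to at least \<open>n - 1\<close>.
\<close>
lemma (in pair_graph) nonadjacent_common_neighbour:
  assumes "u \<in> pverts G" "v \<in> pverts G" "u \<noteq> v" "(u, v) \<notin> parcs G"
    and large: "card (pverts G) \<le> card (neighbours G u) + card (neighbours G v) + 1"
  obtains w where "(u, w) \<in> parcs G" "(w, v) \<in> parcs G"
proof -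
  have adj_sym: "(b, a) \<in> parcs G" if "(a, b) \<in> parcs G" for a b
    using that pair_sym_arcs by (auto simp: symmetric_def dest: symD)
  have finite_neighbours: "finite (neighbours G x)" for x
    using pair_finite_arcs by simp
  have "neighbours G u \<union> neighbours G v \<subseteq> pverts G - {u, v}"
    using assms(4) adj_sym by (auto dest: wellformed' pair_no_loops)
  then have "card (neighbours G u \<union> neighbours G v) \<le> card (pverts G - {u, v})"
    using pair_finite_verts by (intro card_mono) auto
  also have "\<dots> = card (pverts G) - 2"
    using assms(1-3) by (simp add: card_Diff_subset)
  finally have small: "card (neighbours G u \<union> neighbours G v) \<le> card (pverts G) - 2" .
  have "card {u, v} \<le> card (pverts G)"
    using assms(1,2) pair_finite_verts by (intro card_mono) auto
  then have "card (pverts G) \<ge> 2"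
    using assms(3) by simp
  have "neighbours G u \<inter> neighbours G v \<noteq> {}"
  proof
    assume "neighbours G u \<inter> neighbours G v = {}"
    then have "card (neighbours G u \<union> neighbours G v)
        = card (neighbours G u) + card (neighbours G v)"
      using finite_neighbours by (intro card_Un_disjoint)
    then show False
      using small large \<open>card (pverts G) \<ge> 2\<close> by linarith
  qed
  then show thesis
    using that adj_sym by blast
qed

lemma (in pair_wf_digraph) awalk_cost_one: "awalk_cost (\<lambda>_. 1) p = real (length p)"
  by (induction p) simp_all

lemma (in pair_wf_digraph) graph_dist_le_length:
  assumes "awalk u p v"
  shows "graph_dist G u v \<le> ereal (real (length p))"
  using min_cost_le_walk_cost[OF assms, of "\<lambda>_. 1"]
  by (simp add: graph_dist_def awalk_cost_one)

lemma (in pair_wf_digraph) two_le_graph_dist: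
  assumes "u \<noteq> v" "(u, v) \<notin> parcs G"
  shows "2 \<le> graph_dist G u v"
proof -
  have "2 \<le> length p" if "awalk u p v" for p
  proof (rule ccontr)
    assume "\<not> 2 \<le> length p"
    then consider "p = []" | e where "p = [e]"
      by (cases p; cases "tl p") auto
    then show False
      using that assms by cases (auto simp: awalk_def)
  qed
  then have "ereal 2 \<le> ereal (real (length p))" if "awalk u p v" for p
    using that by fastforce
  then show ?thesis
    by (auto simp: graph_dist_def \<mu>_def awalk_cost_one intro!: INF_greatest)
qed

theorem proposition2p1:
  fixes \<Gamma> :: "'a pair_pre_digraph"
  assumes "pair_graph \<Gamma>"
    and "card (pverts \<Gamma>) > 1"
    and "regular \<Gamma>"
    and "self_complementary \<Gamma>"
  shows "connected (with_proj \<Gamma>) \<and> graph_diameter \<Gamma> = 2"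
proof -
  interpret pair_graph \<Gamma> by fact
  have "pverts \<Gamma> \<noteq> {}"
    using assms(2) by auto
  obtain k where degree: "card (neighbours \<Gamma> v) = k" if "v \<in> pverts \<Gamma>" for v
    using assms(3) by (auto simp: regular_def out_degree_eq_card_neighbours)
  then have order: "card (pverts \<Gamma>) = 2 * k + 1"
    using regular_self_complementary_card_verts \<open>pverts \<Gamma> \<noteq> {}\<close> assms(4) by blast

  have short_walk: "\<exists>p. awalk u p v \<and> length p \<le> 2"
    if uv: "u \<in> pverts \<Gamma>" "v \<in> pverts \<Gamma>" for u v
  proof -
    consider "u = v" | "(u, v) \<in> parcs \<Gamma>" | "u \<noteq> v" "(u, v) \<notin> parcs \<Gamma>"
      by blast
    then show ?thesis
    proof cases
      case 1
      then have "awalk u [] v" using uv by (simp add: awalk_def)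
      then show ?thesis by (intro exI[of _ "[]"]) simp
    next
      case 2
      then have "awalk u [(u, v)] v" using uv by (simp add: awalk_def)
      then show ?thesis by (intro exI[of _ "[(u, v)]"]) simp
    next
      case 3
      then obtain w where "(u, w) \<in> parcs \<Gamma>" "(w, v) \<in> parcs \<Gamma>"
        using nonadjacent_common_neighbour uv degree order by (metis mult_2 order_refl)
      then have "awalk u [(u, w), (w, v)] v" using uv by (simp add: awalk_def)
      then show ?thesis by (intro exI[of _ "[(u, w), (w, v)]"]) simp
    qed
  qed

  have "connected (with_proj \<Gamma>)"
    using short_walk \<open>pverts \<Gamma> \<noteq> {}\<close>
    by (intro connectedI reachable_mk_symmetricI) (auto simp only: reachable_awalk with_proj_simps)
  moreover have "graph_diameter \<Gamma> = 2"
  proof (rule antisym)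
    have "graph_dist \<Gamma> u v \<le> 2" if uv: "u \<in> pverts \<Gamma>" "v \<in> pverts \<Gamma>" for u v
    proof -
      obtain p where "awalk u p v" "length p \<le> 2"
        using short_walk uv by blast
      then have "graph_dist \<Gamma> u v \<le> ereal (real (length p))"
        by (intro graph_dist_le_length)
      also have "\<dots> \<le> ereal 2"
        using \<open>length p \<le> 2\<close> by simp
      finally show ?thesis by simp
    qed
    then show "graph_diameter \<Gamma> \<le> 2"
      by (auto simp: graph_diameter_def intro!: SUP_least)
  next
    obtain u where u: "u \<in> pverts \<Gamma>"
      using \<open>pverts \<Gamma> \<noteq> {}\<close> by blast
    have "neighbours \<Gamma> u \<subseteq> pverts \<Gamma>"
      by (auto dest: wellformed')
    \<comment> \<open>Since \<open>k \<noteq> 0\<close>, there are \<open>k < 2 k = n - 1\<close> neighbours of \<open>u\<close>: some other vertex is missed.\<close>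
    have "\<not> pverts \<Gamma> - {u} \<subseteq> neighbours \<Gamma> u"
    proof
      assume "pverts \<Gamma> - {u} \<subseteq> neighbours \<Gamma> u"
      then have "card (pverts \<Gamma> - {u}) \<le> k"
        using degree[OF u] pair_finite_arcs by (metis card_mono finite.emptyI finite.insertI finite_Image)
      then show False
        using u order assms(2) by simp
    qed
    then obtain v where v: "v \<in> pverts \<Gamma>" "u \<noteq> v" "(u, v) \<notin> parcs \<Gamma>"
      by blast
    then have "2 \<le> graph_dist \<Gamma> u v"
      by (intro two_le_graph_dist)
    also have "\<dots> \<le> graph_diameter \<Gamma>"
      unfolding graph_diameter_def using u v by (meson SUP_upper2 order_refl)
    finally show "2 \<le> graph_diameter \<Gamma>" .
  qed
  ultimately show ?thesis ..
qed

end
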